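(* Let $X$ be a finite digital image, let $Y$ be a digital image, and let $f,g:X\to Y$ be strongly homotopic. Then the induced homomorphisms on simplicial homology $f_*,g_*:H_q(X)\to H_q(Y)$ are equal for each $q\ge 0$.
   Context: A digital image is a set $X$ with a symmetric, antireflexive adjacency relation. A function between digital images is continuous if it sends adjacent points to points that are adjacent or equal. For integers $a\le b$, $[a,b]_{\mathbb{Z}}=\{a,\dots,b\}$, with $s,t$ adjacent iff $|s-t|=1$. Strong homotopy. On $X\times[0,k]_{\mathbb{Z}}$ let $\mathrm{NP}_2$ be the adjacency in which two distinct points $(x,t),(x',t')$ are adjacent iff $x,x'$ are adjacent or equal and $t,t'$ are adjacent or equal. Continuous functions $f,g:X\to Y$ are strongly homotopic if for some positive integer $k$ there is a function $H:X\times[0,k]_{\mathbb{Z}}\to Y$, continuous with respect to $\mathrm{NP}_2$ on the domain, with $H(x,0)=f(x)$ and $H(x,k)=g(x)$ for all $x\in X$. Simplicial homology. A $q$-simplex in $X$ is a set of $q+1$ distinct mutually adjacent points; an ordered $q$-simplex is a listing $\langle x_0,\dots,x_q\rangle$ of such points. $C_q(X)$ is the abelian group generated by all ordered $q$-simplices subject to $\langle x_0,\dots,x_q\rangle = (-1)^\rho\langle x_{\rho(0)},\dots,x_{\rho(q)}\rangle$ for every permutation $\rho$ of $\{0,\dots,q\}$, where $(-1)^\rho$ is the sign of $\rho$. The boundary is $\partial_q\langle x_0,\dots,x_q\rangle = \sum_{i=0}^q (-1)^i\langle x_0,\dots,\widehat{x_i},\dots,x_q\rangle$ (with $\partial_0=0$).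 $H_q(X)$ is the $q$-th homology group of the chain complex $(C_q(X),\partial_q)$. A continuous $f:X\to Y$ induces a chain map $f_\#\langle x_0,\dots,x_q\rangle=\langle f(x_0),\dots,f(x_q)\rangle$, where the right side is interpreted as $0$ if $f(x_0),\dots,f(x_q)$ are not all distinct; $f_*$ is the induced map on homology. *)

theory Defs
  imports
    "HOL-Algebra.Free_Abelian_Groups"
    "HOL-Combinatorics.Permutations"
begin

section \<open>Digital images, continuity and strong homotopy\<close>

locale digital_image =
  fixes X :: "'a set" and adj :: "'a \<Rightarrow> 'a \<Rightarrow> bool"
  assumes adj_sym: "\<lbrakk>x \<in> X; y \<in> X; adj x y\<rbrakk> \<Longrightarrow> adj y x"
    and adj_irrefl: "x \<in> X \<Longrightarrow> \<not> adj x x"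

definition adj_or_eq :: "('a \<Rightarrow> 'a \<Rightarrow> bool) \<Rightarrow> 'a \<Rightarrow> 'a \<Rightarrow> bool" where
  "adj_or_eq adj x y \<longleftrightarrow> adj x y \<or> x = y"

definition digitally_continuous ::
    "'a set \<Rightarrow> ('a \<Rightarrow> 'a \<Rightarrow> bool) \<Rightarrow> 'b set \<Rightarrow> ('b \<Rightarrow> 'b \<Rightarrow> bool) \<Rightarrow> ('a \<Rightarrow> 'b) \<Rightarrow> bool" where
  "digitally_continuous X adjX Y adjY f \<longleftrightarrow>
     f ` X \<subseteq> Y \<and> (\<forall>x\<in>X. \<forall>x'\<in>X. adjX x x' \<longrightarrow> adj_or_eq adjY (f x) (f x'))"

definition int_adj :: "int \<Rightarrow> int \<Rightarrow> bool" where
  "int_adj s t \<longleftrightarrow> \<bar>s - t\<bar> = 1"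

definition NP2 :: "('a \<Rightarrow> 'a \<Rightarrow> bool) \<Rightarrow> ('b \<Rightarrow> 'b \<Rightarrow> bool) \<Rightarrow> 'a \<times> 'b \<Rightarrow> 'a \<times> 'b \<Rightarrow> bool" where
  "NP2 adjX adjY p p' \<longleftrightarrow>
     p \<noteq> p' \<and> adj_or_eq adjX (fst p) (fst p') \<and> adj_or_eq adjY (snd p) (snd p')"

definition strongly_homotopic ::
    "'a set \<Rightarrow> ('a \<Rightarrow> 'a \<Rightarrow> bool) \<Rightarrow> 'b set \<Rightarrow> ('b \<Rightarrow> 'b \<Rightarrow> bool) \<Rightarrow> ('a \<Rightarrow> 'b) \<Rightarrow> ('a \<Rightarrow> 'b) \<Rightarrow> bool" where
  "strongly_homotopic X adjX Y adjY f g \<longleftrightarrow>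
     (\<exists>k::int. k > 0 \<and>
       (\<exists>H. digitally_continuous (X \<times> {0..k}) (NP2 adjX int_adj) Y adjY H \<and>
            (\<forall>x\<in>X. H (x, 0) = f x \<and> H (x, k) = g x)))"

section \<open>Simplicial chain groups\<close>

definition ordered_simplices :: "nat \<Rightarrow> 'a set \<Rightarrow> ('a \<Rightarrow> 'a \<Rightarrow> bool) \<Rightarrow> 'a list set" where
  "ordered_simplices q X adj =
     {xs. length xs = q + 1 \<and> set xs \<subseteq> X \<and> distinct xs \<and> pairwise adj (set xs)}"

abbreviation free_chain_group ::
    "nat \<Rightarrow> 'a set \<Rightarrow> ('a \<Rightarrow> 'a \<Rightarrow> bool) \<Rightarrow> ('a list \<Rightarrow>\<^sub>0 int) monoid" where
  "free_chain_group q X adj \<equiv> free_Abelian_group (ordered_simplices q X adj)"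

text \<open>The defining relations \<open>\<langle>x\<^sub>0,\<dots>,x\<^sub>q\<rangle> = (-1)\<^sup>\<rho> \<langle>x\<^bsub>\<rho>(0)\<^esub>,\<dots>,x\<^bsub>\<rho>(q)\<^esub>\<rangle>\<close>, as the subgroup
  of the free abelian group by which one divides.\<close>

definition orientation_relations ::
    "nat \<Rightarrow> 'a set \<Rightarrow> ('a \<Rightarrow> 'a \<Rightarrow> bool) \<Rightarrow> ('a list \<Rightarrow>\<^sub>0 int) set" where
  "orientation_relations q X adj =
     generate (free_chain_group q X adj)
       {frag_of xs - frag_cmul (sign \<rho>) (frag_of (permute_list \<rho> xs)) | xs \<rho>.
          xs \<in> ordered_simplices q X adj \<and> \<rho> permutes {0..q}}"

definition simplicial_chain_group ::
    "nat \<Rightarrow> 'a set \<Rightarrow> ('a \<Rightarrow> 'a \<Rightarrow> bool) \<Rightarrow> ('a list \<Rightarrow>\<^sub>0 int) set monoid" where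
  "simplicial_chain_group q X adj = free_chain_group q X adj Mod orientation_relations q X adj"

text \<open>The map from cosets in the domain to cosets of \<open>N\<close> in \<open>G\<close> that is induced by a map \<open>h\<close> of
  representatives: \<open>A\<close> is sent to the coset \<open>N #> h a\<close>, which does not depend on \<open>a \<in> A\<close>
  when \<open>h\<close> is a homomorphism respecting the subgroups.\<close>

definition quotient_map_of ::
    "('b, 'm) monoid_scheme \<Rightarrow> 'b set \<Rightarrow> ('a \<Rightarrow> 'b) \<Rightarrow> 'a set \<Rightarrow> 'b set" where
  "quotient_map_of G N h A = the_elem ((\<lambda>a. N #>\<^bsub>G\<^esub> h a) ` A)"

definition simplex_boundary :: "'a list \<Rightarrow> 'a list \<Rightarrow>\<^sub>0 int" where
  "simplex_boundary xs =
     (\<Sum>i<length xs. frag_cmul ((-1) ^ i) (frag_of (take i xs @ drop (Suc i) xs)))"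

text \<open>For \<open>q = 0\<close> the boundary is the zero map; as there is no group of chains of degree \<open>-1\<close>,
  its codomain is then taken to be the chain group of degree \<open>0 - 1 = (0::nat)\<close>, which does
  not affect its kernel.\<close>

definition boundary ::
    "nat \<Rightarrow> 'a set \<Rightarrow> ('a \<Rightarrow> 'a \<Rightarrow> bool) \<Rightarrow> ('a list \<Rightarrow>\<^sub>0 int) set \<Rightarrow> ('a list \<Rightarrow>\<^sub>0 int) set" where
  "boundary q X adj =
     (if q = 0 then (\<lambda>_. \<one>\<^bsub>simplicial_chain_group 0 X adj\<^esub>)
      else quotient_map_of (free_chain_group (q - 1) X adj) (orientation_relations (q - 1) X adj)
             (frag_extend simplex_boundary))"

section \<open>Simplicial homology and induced homomorphisms\<close>

definition simplicial_cycles ::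
    "nat \<Rightarrow> 'a set \<Rightarrow> ('a \<Rightarrow> 'a \<Rightarrow> bool) \<Rightarrow> ('a list \<Rightarrow>\<^sub>0 int) set set" where
  "simplicial_cycles q X adj =
     kernel (simplicial_chain_group q X adj) (simplicial_chain_group (q - 1) X adj)
       (boundary q X adj)"

definition simplicial_boundaries ::
    "nat \<Rightarrow> 'a set \<Rightarrow> ('a \<Rightarrow> 'a \<Rightarrow> bool) \<Rightarrow> ('a list \<Rightarrow>\<^sub>0 int) set set" where
  "simplicial_boundaries q X adj =
     boundary (q + 1) X adj ` carrier (simplicial_chain_group (q + 1) X adj)"

abbreviation cycle_group ::
    "nat \<Rightarrow> 'a set \<Rightarrow> ('a \<Rightarrow> 'a \<Rightarrow> bool) \<Rightarrow> ('a list \<Rightarrow>\<^sub>0 int) set monoid" where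
  "cycle_group q X adj \<equiv>
     subgroup_generated (simplicial_chain_group q X adj) (simplicial_cycles q X adj)"

definition simplicial_homology_group ::
    "nat \<Rightarrow> 'a set \<Rightarrow> ('a \<Rightarrow> 'a \<Rightarrow> bool) \<Rightarrow> ('a list \<Rightarrow>\<^sub>0 int) set set monoid" where
  "simplicial_homology_group q X adj = cycle_group q X adj Mod simplicial_boundaries q X adj"

definition simplex_image :: "('a \<Rightarrow> 'b) \<Rightarrow> 'a list \<Rightarrow> 'b list \<Rightarrow>\<^sub>0 int" where
  "simplex_image f xs = (if distinct (map f xs) then frag_of (map f xs) else 0)"

text \<open>The induced maps \<open>f\<^sub>#\<close> on chains and \<open>f\<^sub>*\<close> on homology take only the codomain image
  \<open>(Y, adj)\<close> as an argument; the domain image enters through the cosets they are applied to.\<close>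

definition induced_chain_map ::
    "nat \<Rightarrow> 'b set \<Rightarrow> ('b \<Rightarrow> 'b \<Rightarrow> bool) \<Rightarrow> ('a \<Rightarrow> 'b) \<Rightarrow>
     ('a list \<Rightarrow>\<^sub>0 int) set \<Rightarrow> ('b list \<Rightarrow>\<^sub>0 int) set" where
  "induced_chain_map q Y adj f =
     quotient_map_of (free_chain_group q Y adj) (orientation_relations q Y adj)
       (frag_extend (simplex_image f))"

definition induced_homology_map ::
    "nat \<Rightarrow> 'b set \<Rightarrow> ('b \<Rightarrow> 'b \<Rightarrow> bool) \<Rightarrow> ('a \<Rightarrow> 'b) \<Rightarrow>
     ('a list \<Rightarrow>\<^sub>0 int) set set \<Rightarrow> ('b list \<Rightarrow>\<^sub>0 int) set set" where
  "induced_homology_map q Y adj f =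
     quotient_map_of (cycle_group q Y adj) (simplicial_boundaries q Y adj)
       (induced_chain_map q Y adj f)"

end

theory Submission
  imports Defs
begin

text \<open>
  It suffices to treat one step of the homotopy, that is, maps \<open>f\<close> and \<open>g\<close> sending points that
  are adjacent or equal to points that are adjacent or equal in all four combinations. Since \<open>X\<close> is
  finite, one may change \<open>f\<close> into \<open>g\<close> one vertex at a time; all intermediate maps are
  continuous. If \<open>f\<close> and \<open>g\<close> differ only at \<open>v\<close>, then
  \<open>\<langle>x\<^sub>0,\<dots>,x\<^sub>i = v,\<dots>,x\<^sub>q\<rangle> \<mapsto> (-1)\<^sup>i \<langle>f x\<^sub>0,\<dots>,f v,g v,\<dots>,f x\<^sub>q\<rangle>\<close> (and \<open>0\<close> on simplices avoiding \<open>v\<close>)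
  is a chain homotopy from \<open>f\<close> to \<open>g\<close>. Unlike the usual prism operator it involves no choice
  of an ordering of the vertices, so it respects the orientation relations. All identities are
  checked on representatives in the free groups, modulo the orientation relations.
\<close>

section \<open>Alternating functions of ordered simplices\<close>

lemma permute_list_transpose:
  assumes "a < length xs" "b < length xs"
  shows "permute_list (transpose a b) xs = xs[a := xs ! b, b := xs ! a]"
  using assms
  by (intro nth_equalityI) (auto simp: permute_list_def nth_list_update transpose_def)

lemma frag_cmul_diff_right: "frag_cmul k (a - b) = frag_cmul k a - frag_cmul k b"
  by (simp add: poly_mapping_eqI lookup_minus right_diff_distrib)

text \<open>Membership is taken in a bare set of formal sums, with no ambient carrier. The instances
  are the orientation relations, the preimages of such a set under
  \<open>frag_extend \<phi>\<close>, and the sums supported on given simplices.\<close>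

locale frag_subgroup =
  fixes S :: "('a \<Rightarrow>\<^sub>0 int) set"
  assumes zero: "0 \<in> S"
    and diff: "\<lbrakk>a \<in> S; b \<in> S\<rbrakk> \<Longrightarrow> a - b \<in> S"
begin

lemma minus: "a \<in> S \<Longrightarrow> - a \<in> S"
  using diff[OF zero] by simp

lemma add: "\<lbrakk>a \<in> S; b \<in> S\<rbrakk> \<Longrightarrow> a + b \<in> S"
  using diff[of a "- b"] minus by simp

lemma cmul: "a \<in> S \<Longrightarrow> frag_cmul k a \<in> S"
  using frag_closure_minus_cmul[of "\<lambda>a. a \<in> S"] zero diff by blast

lemma sum: "(\<And>i. i \<in> I \<Longrightarrow> f i \<in> S) \<Longrightarrow> sum f I \<in> S"
  by (induction I rule: infinite_finite_induct) (auto intro: zero add)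

text \<open>Three exchanges give one sign: carry \<open>x\<close> past \<open>b\<close>, exchange
  \<open>x\<close> and \<open>y\<close> further right by induction, then carry \<open>y\<close> back
  past \<open>b\<close>. The multiset \<open>M\<close> stays fixed because \<open>adjacent\<close>
  is available only for rearrangements of one list.\<close>

lemma alternating_swap:
  assumes adjacent: "\<And>as x y bs. mset (as @ x # y # bs) = M \<Longrightarrow>
      \<phi> (as @ x # y # bs) + \<phi> (as @ y # x # bs) \<in> S"
    and "mset (as @ x # bs @ y # cs) = M"
  shows "\<phi> (as @ x # bs @ y # cs) + \<phi> (as @ y # bs @ x # cs) \<in> S"
  using assms(2)
proof (induction bs arbitrary: as)
  case Nil
  then show ?case using adjacent[of as x y cs] by simp
next
  case (Cons b bs)
  have "\<phi> (as @ x # b # (bs @ y # cs)) + \<phi> (as @ b # x # (bs @ y # cs)) \<in> S"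
    using Cons.prems by (intro adjacent) simp
  moreover have "\<phi> ((as @ [b]) @ x # bs @ y # cs) + \<phi> ((as @ [b]) @ y # bs @ x # cs) \<in> S"
    using Cons.prems by (intro Cons.IH) (simp add: add_mset_commute)
  moreover have "\<phi> (as @ b # y # (bs @ x # cs)) + \<phi> (as @ y # b # (bs @ x # cs)) \<in> S"
    using Cons.prems by (intro adjacent) (auto simp: add_mset_commute)
  ultimately have "(\<phi> (as @ x # b # (bs @ y # cs)) + \<phi> (as @ b # x # (bs @ y # cs)))
     - (\<phi> ((as @ [b]) @ x # bs @ y # cs) + \<phi> ((as @ [b]) @ y # bs @ x # cs))
     + (\<phi> (as @ b # y # (bs @ x # cs)) + \<phi> (as @ y # b # (bs @ x # cs))) \<in> S"
    by (fast intro: add diff)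
  then show ?case by (simp add: algebra_simps)
qed

text \<open>Each element of \<open>bs\<close> that \<open>x\<close> passes contributes one factor
  -1.\<close>

lemma alternating_move:
  assumes adjacent: "\<And>as x y bs. mset (as @ x # y # bs) = M \<Longrightarrow>
      \<phi> (as @ x # y # bs) + \<phi> (as @ y # x # bs) \<in> S"
    and "mset (as @ x # bs @ cs) = M"
  shows "\<phi> (as @ x # bs @ cs) - frag_cmul ((-1) ^ length bs) (\<phi> (as @ bs @ x # cs)) \<in> S"
  using assms(2)
proof (induction bs arbitrary: as)
  case Nil
  then show ?case by (simp add: zero)
next
  case (Cons b bs)
  have "\<phi> (as @ x # b # (bs @ cs)) + \<phi> (as @ b # x # (bs @ cs)) \<in> S"
    using Cons.prems by (intro adjacent) simp
  moreover have "\<phi> ((as @ [b]) @ x # bs @ cs)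
      - frag_cmul ((-1) ^ length bs) (\<phi> ((as @ [b]) @ bs @ x # cs)) \<in> S"
    using Cons.prems by (intro Cons.IH) (simp add: add_mset_commute)
  ultimately have "(\<phi> (as @ x # b # (bs @ cs)) + \<phi> (as @ b # x # (bs @ cs)))
     - (\<phi> ((as @ [b]) @ x # bs @ cs)
        - frag_cmul ((-1) ^ length bs) (\<phi> ((as @ [b]) @ bs @ x # cs))) \<in> S"
    by (rule diff)
  then show ?case
    by (simp add: algebra_simps flip: minus_frag_cmul)
qed

text \<open>Translates \<open>alternating_swap\<close> to positions, by cutting \<open>xs\<close> at
  \<open>a\<close> and \<open>b\<close>.\<close>

lemma alternating_transpose:
  assumes adjacent: "\<And>as x y bs. mset (as @ x # y # bs) = mset xs \<Longrightarrow>
      \<phi> (as @ x # y # bs) + \<phi> (as @ y # x # bs) \<in> S"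
    and ab: "a < b" "b < length xs"
  shows "\<phi> xs + \<phi> (permute_list (transpose a b) xs) \<in> S"
proof -
  define us vs ws where "us = take a xs" and "vs = take (b - Suc a) (drop (Suc a) xs)"
    and "ws = drop (Suc b) xs"
  have xs: "xs = us @ xs ! a # vs @ xs ! b # ws"
  proof -
    have "xs = us @ xs ! a # drop (Suc a) xs"
      using ab unfolding us_def by (intro id_take_nth_drop) simp
    also have "drop (Suc a) xs = vs @ drop (b - Suc a) (drop (Suc a) xs)"
      unfolding vs_def by (simp del: drop_drop)
    also have "drop (b - Suc a) (drop (Suc a) xs) = drop b xs"
      using ab by simp
    also have "\<dots> = xs ! b # ws"
      using ab unfolding ws_def by (simp add: Cons_nth_drop_Suc)
    finally show ?thesis .
  qed
  have len: "length us = a" "length vs = b - Suc a"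
    using ab by (auto simp: us_def vs_def)
  have "permute_list (transpose a b) xs = us @ xs ! b # vs @ xs ! a # ws" (is "?l = ?r")
  proof -
    have "?l = xs[a := xs ! b, b := xs ! a]"
      using ab by (intro permute_list_transpose) simp_all
    also have "\<dots> = (us @ xs ! a # vs @ xs ! b # ws)[a := xs ! b, b := xs ! a]"
      by (rule arg_cong[OF xs])
    also have "\<dots> = ?r"
      using ab len by (auto simp: list_update_append split: nat.split)
    finally show ?thesis .
  qed
  moreover have "\<phi> (us @ xs ! a # vs @ xs ! b # ws) + \<phi> (us @ xs ! b # vs @ xs ! a # ws) \<in> S"
    by (rule alternating_swap[where \<phi> = \<phi> and M = "mset xs"], rule adjacent) (simp_all flip: xs)
  ultimately show ?thesis by (simp flip: xs)
qed

text \<open>A permutation is a product of transpositions, and each of them negates both the sign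
  and, modulo \<open>S\<close>, the value of \<open>\<phi>\<close>.\<close>

lemma alternating_permute:
  assumes "\<rho> permutes {..<length xs}"
    and "\<And>as x y bs. mset (as @ x # y # bs) = mset xs \<Longrightarrow>
      \<phi> (as @ x # y # bs) + \<phi> (as @ y # x # bs) \<in> S"
  shows "\<phi> xs - frag_cmul (sign \<rho>) (\<phi> (permute_list \<rho> xs)) \<in> S"
proof -
  define n where "n = length xs"
  have "\<rho> permutes {..<n}" "finite {..<n}" using assms by (simp_all add: n_def)
  \<comment> \<open>Quantifying over all rearrangements \<open>ys\<close> lets the induction
    hypothesis for \<open>p\<close> be applied to the list that has already been transposed.\<close>
  then have "\<forall>ys. mset ys = mset xs \<longrightarrow>
      \<phi> ys - frag_cmul (sign \<rho>) (\<phi> (permute_list \<rho> ys)) \<in> S"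
  proof (induction \<rho> rule: permutes_induct)
    case id
    then show ?case by (simp add: zero)
  next
    case (swap a b p)
    show ?case
    proof (intro allI impI)
      fix ys assume ys: "mset ys = mset xs"
      then have len: "length ys = n" unfolding n_def by (rule mset_eq_length)
      define zs where "zs = permute_list (transpose a b) ys"
      have tr: "transpose a b permutes {..<length ys}"
        using swap len by (intro permutes_swap_id) auto
      have zs: "mset zs = mset xs"
        using tr ys by (simp add: zs_def)
      have *: "\<phi> ys + \<phi> (permute_list (transpose c d) ys) \<in> S"
        if "c < d" "d < length ys" for c d
        by (rule alternating_transpose[where \<phi> = \<phi>], rule assms(2)) (simp_all add: ys that)
      have "a < b \<or> b < a" using swap by auto
      then have yz: "\<phi> ys + \<phi> zs \<in> S"
        using *[of a b] *[of b a] swap len by (auto simp: zs_def transpose_commute)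
      have IH: "\<phi> zs - frag_cmul (sign p) (\<phi> (permute_list p zs)) \<in> S"
        using swap zs by blast
      have "permute_list (transpose a b \<circ> p) ys = permute_list p zs"
        unfolding zs_def using swap len by (intro permute_list_compose) simp
      moreover have "sign (transpose a b \<circ> p) = - sign p"
      proof -
        have "permutation p"
          using swap finite_lessThan[of n] unfolding permutation_permutes by blast
        then show ?thesis
          using swap by (simp add: sign_compose permutation_swap_id sign_swap_id)
      qed
      moreover have "(\<phi> ys + \<phi> zs) - (\<phi> zs - frag_cmul (sign p) (\<phi> (permute_list p zs))) \<in> S"
        using yz IH by (rule diff)
      ultimately show "\<phi> ys - frag_cmul (sign (transpose a b \<circ> p))
          (\<phi> (permute_list (transpose a b \<circ> p) ys)) \<in> S"
        by simp
    qed
  qed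
  then show ?thesis by blast
qed

end

text \<open>The condition on keys puts \<open>B\<close> inside the carrier, where the group inverse
  is unary minus; this settles the inverse case of \<open>generate\<close>.\<close>

lemma generate_free_Abelian_group_subset:
  assumes "frag_subgroup S" and "B \<subseteq> S" and "\<And>c. c \<in> B \<Longrightarrow> Poly_Mapping.keys c \<subseteq> T"
  shows "generate (free_Abelian_group T) B \<subseteq> S"
proof
  interpret frag_subgroup S by fact
  fix c assume "c \<in> generate (free_Abelian_group T) B"
  then show "c \<in> S"
    by induction (use assms in \<open>auto simp: zero add minus\<close>)
qed

section \<open>The orientation relations as a subgroup, and maps that respect them\<close>

lemma mset_mem_ordered_simplices:
  "mset xs = mset ys \<Longrightarrow> xs \<in> ordered_simplices q X adj \<longleftrightarrow> ys \<in> ordered_simplices q X adj"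
  unfolding ordered_simplices_def
  by (auto dest: mset_eq_length mset_eq_setD mset_eq_imp_distinct_iff)

lemma permute_list_mem_ordered_simplices:
  assumes "xs \<in> ordered_simplices q X adj" and "\<rho> permutes {0..q}"
  shows "permute_list \<rho> xs \<in> ordered_simplices q X adj" "\<rho> permutes {..<length xs}"
proof -
  have "length xs = q + 1" using assms by (simp add: ordered_simplices_def)
  then show *: "\<rho> permutes {..<length xs}"
    using assms by (simp add: atLeast0AtMost lessThan_Suc_atMost)
  show "permute_list \<rho> xs \<in> ordered_simplices q X adj"
    using assms mset_mem_ordered_simplices[OF mset_permute_list[OF *], of q X adj] by simp
qed

lemma orientation_relation_keys:
  assumes "xs \<in> ordered_simplices q X adj" and "\<rho> permutes {0..q}"
  shows "Poly_Mapping.keys (frag_of xs - frag_cmul (sign \<rho>) (frag_of (permute_list \<rho> xs)))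
    \<subseteq> ordered_simplices q X adj"
  using assms permute_list_mem_ordered_simplices[OF assms]
  by (auto dest!: subsetD[OF keys_diff])

lemma subgroup_orientation_relations:
  "subgroup (orientation_relations q X adj) (free_chain_group q X adj)"
  unfolding orientation_relations_def
proof (rule group.generate_is_subgroup)
  show "{frag_of xs - frag_cmul (sign \<rho>) (frag_of (permute_list \<rho> xs)) | xs \<rho>.
      xs \<in> ordered_simplices q X adj \<and> \<rho> permutes {0..q}} \<subseteq> carrier (free_chain_group q X adj)"
    by clarify (simp only: carrier_free_Abelian_group_iff orientation_relation_keys)
qed simp

lemma frag_subgroup_orientation_relations:
  "frag_subgroup (orientation_relations q X adj)"
proof -
  let ?R = "orientation_relations q X adj"
  interpret subgroup ?R "free_chain_group q X adj"
    by (rule subgroup_orientation_relations)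
  show ?thesis
  proof
    show "0 \<in> ?R" using one_closed by simp
    fix a b assume ab: "a \<in> ?R" "b \<in> ?R"
    have "Poly_Mapping.keys b \<subseteq> ordered_simplices q X adj"
      using subset ab(2) by (metis carrier_free_Abelian_group_iff subsetD)
    then have "- b \<in> ?R" using m_inv_closed[OF ab(2)] by simp
    then show "a - b \<in> ?R" using m_closed[of a "- b"] ab by simp
  qed
qed

interpretation orientation: frag_subgroup "orientation_relations q X adj" for q X adj
  by (rule frag_subgroup_orientation_relations)

text \<open>The formal sums that \<open>frag_extend \<phi>\<close> sends into \<open>S\<close> form
  a subgroup, which contains every generating relation by \<open>alternating_permute\<close>. With
  this criterion the boundary, the chain maps and the prism descend to chain groups once a swap of
  two neighbouring entries is understood.\<close>

lemma alternating_respects_orientation: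
  assumes S: "frag_subgroup S"
    and adjacent: "\<And>as x y bs. as @ x # y # bs \<in> ordered_simplices q X adj \<Longrightarrow>
      \<phi> (as @ x # y # bs) + \<phi> (as @ y # x # bs) \<in> S"
    and "c \<in> orientation_relations q X adj"
  shows "frag_extend \<phi> c \<in> S"
proof -
  interpret frag_subgroup S by fact
  have "orientation_relations q X adj \<subseteq> {c. frag_extend \<phi> c \<in> S}"
    unfolding orientation_relations_def
  proof (rule generate_free_Abelian_group_subset)
    show "frag_subgroup {c. frag_extend \<phi> c \<in> S}"
      by unfold_locales (auto simp: frag_extend_diff intro: zero diff)
  next
    show "{frag_of xs - frag_cmul (sign \<rho>) (frag_of (permute_list \<rho> xs)) | xs \<rho>.
        xs \<in> ordered_simplices q X adj \<and> \<rho> permutes {0..q}} \<subseteq> {c. frag_extend \<phi> c \<in> S}"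
    proof clarify
      fix xs \<rho> assume *: "xs \<in> ordered_simplices q X adj" "\<rho> permutes {0..q}"
      have "\<phi> xs - frag_cmul (sign \<rho>) (\<phi> (permute_list \<rho> xs)) \<in> S"
        using permute_list_mem_ordered_simplices(2)[OF *]
      proof (rule alternating_permute[where \<phi> = \<phi>])
        fix as x y bs assume "mset (as @ x # y # bs) = mset xs"
        then have "as @ x # y # bs \<in> ordered_simplices q X adj"
          using mset_mem_ordered_simplices *(1) by blast
        then show "\<phi> (as @ x # y # bs) + \<phi> (as @ y # x # bs) \<in> S"
          by (rule adjacent)
      qed
      then show "frag_extend \<phi> (frag_of xs - frag_cmul (sign \<rho>) (frag_of (permute_list \<rho> xs))) \<in> S"
        by (simp add: frag_extend_diff frag_extend_cmul)
    qed
  next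
    fix c assume "c \<in> {frag_of xs - frag_cmul (sign \<rho>) (frag_of (permute_list \<rho> xs)) | xs \<rho>.
        xs \<in> ordered_simplices q X adj \<and> \<rho> permutes {0..q}}"
    then show "Poly_Mapping.keys c \<subseteq> ordered_simplices q X adj"
      by clarify (rule subsetD[OF orientation_relation_keys])
  qed
  then show ?thesis using assms(3) by blast
qed

section \<open>Boundaries of possibly degenerate simplices\<close>

text \<open>Repetitions are allowed here: these are the images of ordered simplices under continuous maps.\<close>

definition weak_simplices :: "nat \<Rightarrow> 'a set \<Rightarrow> ('a \<Rightarrow> 'a \<Rightarrow> bool) \<Rightarrow> 'a list set" where
  "weak_simplices q X adj =
     {xs. length xs = q + 1 \<and> set xs \<subseteq> X \<and> (\<forall>x\<in>set xs. \<forall>y\<in>set xs. adj_or_eq adj x y)}"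

text \<open>Vanishing on lists with repetitions is the convention for images of simplices, and it
  makes this function alternate, modulo the orientation relations, on all weak simplices.\<close>

definition simplex_class :: "'a list \<Rightarrow> 'a list \<Rightarrow>\<^sub>0 int" where
  "simplex_class xs = (if distinct xs then frag_of xs else 0)"

lemma simplex_image_eq: "simplex_image f xs = simplex_class (map f xs)"
  by (simp add: simplex_image_def simplex_class_def)

lemma ordered_simplices_eq:
  "ordered_simplices q X adj = {xs \<in> weak_simplices q X adj. distinct xs}"
  by (auto simp: ordered_simplices_def weak_simplices_def adj_or_eq_def pairwise_def)

lemma weak_simplices_subset:
  "\<lbrakk>xs \<in> weak_simplices p X adj; set ys \<subseteq> set xs; length ys = q + 1\<rbrakk>
    \<Longrightarrow> ys \<in> weak_simplices q X adj"
  unfolding weak_simplices_def by blast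

lemma mset_mem_weak_simplices:
  "mset xs = mset ys \<Longrightarrow> xs \<in> weak_simplices q X adj \<longleftrightarrow> ys \<in> weak_simplices q X adj"
  by (simp add: weak_simplices_def mset_eq_length[of xs ys] mset_eq_setD[of xs ys])

lemma simplex_class_keys:
  "xs \<in> weak_simplices q X adj \<Longrightarrow>
    Poly_Mapping.keys (simplex_class xs) \<subseteq> ordered_simplices q X adj"
  by (simp add: simplex_class_def ordered_simplices_eq)

lemma permute_list_adjacent_transpose:
  "permute_list (transpose (length as) (Suc (length as))) (as @ x # y # bs) = as @ y # x # bs"
  by (simp add: permute_list_transpose list_update_append nth_append)

text \<open>A list without repetitions gives the defining relation for one transposition, of sign
  -1. A repetition survives the swap, so otherwise both terms are 0.\<close>

lemma simplex_class_swap: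
  assumes "as @ x # y # bs \<in> weak_simplices q X adj"
  shows "simplex_class (as @ x # y # bs) + simplex_class (as @ y # x # bs)
    \<in> orientation_relations q X adj"
proof (cases "distinct (as @ x # y # bs)")
  case True
  let ?xs = "as @ x # y # bs" and ?\<rho> = "transpose (length as) (Suc (length as))"
  have "?xs \<in> ordered_simplices q X adj"
    using assms True by (simp only: ordered_simplices_eq mem_Collect_eq)
  moreover from this have "?\<rho> permutes {0..q}"
    by (intro permutes_swap_id) (auto simp: ordered_simplices_def)
  ultimately have "frag_of ?xs - frag_cmul (sign ?\<rho>) (frag_of (permute_list ?\<rho> ?xs))
      \<in> orientation_relations q X adj"
    unfolding orientation_relations_def by (intro generate.incl) blast
  moreover have "distinct (as @ y # x # bs)" using True by auto
  ultimately show ?thesis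
    using True by (simp add: simplex_class_def permute_list_adjacent_transpose sign_swap_id)
next
  case False
  moreover have "\<not> distinct (as @ y # x # bs)" using False by auto
  ultimately show ?thesis by (simp only: simplex_class_def if_False orientation.zero add_0_left)
qed

lemma simplex_class_move:
  assumes "as @ x # bs @ cs \<in> weak_simplices q X adj"
  shows "simplex_class (as @ x # bs @ cs)
      - frag_cmul ((-1) ^ length bs) (simplex_class (as @ bs @ x # cs))
    \<in> orientation_relations q X adj"
proof (rule orientation.alternating_move[where \<phi> = simplex_class and M = "mset (as @ x # bs @ cs)"])
  fix us u w ws assume "mset (us @ u # w # ws) = mset (as @ x # bs @ cs)"
  from mset_mem_weak_simplices[OF this] assms show "simplex_class (us @ u # w # ws) + simplex_class (us @ w # u # ws)
      \<in> orientation_relations q X adj"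
    by (intro simplex_class_swap) (rule iffD2)
qed simp

text \<open>The boundary formula with an arbitrary \<open>\<phi>\<close> applied to the faces. One
  recursion along lists then serves the boundary, its square, and the composition of the boundary
  with a prism or a chain map.\<close>

definition face_sum :: "('a list \<Rightarrow> 'b \<Rightarrow>\<^sub>0 int) \<Rightarrow> 'a list \<Rightarrow> 'b \<Rightarrow>\<^sub>0 int" where
  "face_sum \<phi> xs = (\<Sum>i<length xs. frag_cmul ((-1) ^ i) (\<phi> (take i xs @ drop (Suc i) xs)))"

lemma frag_extend_simplex_boundary: "frag_extend \<phi> (simplex_boundary xs) = face_sum \<phi> xs"
  by (simp add: simplex_boundary_def face_sum_def frag_extend_sum frag_extend_cmul o_def)

lemma simplex_boundary_eq: "simplex_boundary = face_sum frag_of"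
  by (simp add: fun_eq_iff simplex_boundary_def face_sum_def)

lemma face_sum_map: "face_sum \<phi> (map f xs) = face_sum (\<lambda>zs. \<phi> (map f zs)) xs"
  by (simp add: face_sum_def take_map drop_map)

lemma face_sum_Nil: "face_sum \<phi> [] = 0"
  by (simp add: face_sum_def)

text \<open>In front of \<open>xs\<close> the entry \<open>x\<close> shifts the index of every later
  vertex by one, hence the minus sign.\<close>

lemma face_sum_Cons: "face_sum \<phi> (x # xs) = \<phi> xs - face_sum (\<lambda>zs. \<phi> (x # zs)) xs"
  unfolding face_sum_def
  by (simp add: sum.lessThan_Suc_shift sum_negf[symmetric] del: sum.lessThan_Suc)

lemma face_sum_append:
  "face_sum \<phi> (xs @ ys) =
    face_sum (\<lambda>zs. \<phi> (zs @ ys)) xs + frag_cmul ((-1) ^ length xs) (face_sum (\<lambda>zs. \<phi> (xs @ zs)) ys)"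
proof (induction xs arbitrary: \<phi>)
  case Nil
  then show ?case by (simp add: face_sum_Nil)
next
  case (Cons x xs)
  then show ?case by (simp add: face_sum_Cons algebra_simps flip: minus_frag_cmul)
qed

lemma face_sum_add: "face_sum (\<lambda>zs. \<phi> zs + \<psi> zs) xs = face_sum \<phi> xs + face_sum \<psi> xs"
  by (simp add: face_sum_def frag_cmul_distrib2 sum.distrib)

lemma face_sum_cmul: "face_sum (\<lambda>zs. frag_cmul k (\<phi> zs)) xs = frag_cmul k (face_sum \<phi> xs)"
  by (simp add: face_sum_def frag_cmul_sum mult.commute)

lemma face_properties:
  assumes "i < length xs"
  shows "Suc (length (take i xs @ drop (Suc i) xs)) = length xs"
    and "set (take i xs @ drop (Suc i) xs) \<subseteq> set xs"
    and "distinct xs \<Longrightarrow> distinct (take i xs @ drop (Suc i) xs)"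
  using assms set_take_subset[of i xs] set_drop_subset[of "Suc i" xs]
  by (auto simp: set_take_disj_set_drop_if_distinct)

lemma face_sum_cong:
  assumes "\<And>zs. \<lbrakk>Suc (length zs) = length xs; set zs \<subseteq> set xs; distinct xs \<Longrightarrow> distinct zs\<rbrakk>
    \<Longrightarrow> \<phi> zs = \<psi> zs"
  shows "face_sum \<phi> xs = face_sum \<psi> xs"
  unfolding face_sum_def
proof (rule sum.cong[OF refl])
  fix i assume "i \<in> {..<length xs}"
  then have "i < length xs" by simp
  then show "frag_cmul ((-1) ^ i) (\<phi> (take i xs @ drop (Suc i) xs)) =
      frag_cmul ((-1) ^ i) (\<psi> (take i xs @ drop (Suc i) xs))"
    using assms[OF face_properties] by simp
qed

lemma face_sum_zero: "face_sum (\<lambda>zs. 0) xs = 0"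
  by (simp add: face_sum_def)

lemma (in frag_subgroup) face_sum_mem:
  assumes "\<And>zs. \<lbrakk>Suc (length zs) = length xs; set zs \<subseteq> set xs; distinct xs \<Longrightarrow> distinct zs\<rbrakk>
    \<Longrightarrow> \<phi> zs \<in> S"
  shows "face_sum \<phi> xs \<in> S"
  unfolding face_sum_def using assms[OF face_properties] by (intro sum cmul) simp

text \<open>In the sum of the boundaries of a simplex and its swap, the faces omitting
  \<open>x\<close> or \<open>y\<close> are the same lists with opposite signs and cancel exactly.
  All other faces contain both points and pair up to swaps of neighbours.\<close>

lemma simplex_boundary_orientation:
  assumes "c \<in> orientation_relations (Suc q) X adj"
  shows "frag_extend simplex_boundary c \<in> orientation_relations q X adj"
  using frag_subgroup_orientation_relations _ assms
proof (rule alternating_respects_orientation)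
  let ?R = "orientation_relations q X adj"
  fix as x y bs assume xs: "as @ x # y # bs \<in> ordered_simplices (Suc q) X adj"
  then have weak: "as @ x # y # bs \<in> weak_simplices (Suc q) X adj"
    and dist: "distinct (as @ x # y # bs)"
    and len: "length as + length bs = q"
    by (auto simp: ordered_simplices_eq weak_simplices_def)
  \<comment> \<open>\<open>simplex_boundary\<close> is built from \<open>frag_of\<close>, which
    agrees with \<open>simplex_class\<close> on lists without repetitions only.\<close>
  have swap: "frag_of (us @ x # y # ws) + frag_of (us @ y # x # ws) \<in> ?R"
    if "us @ x # y # ws \<in> weak_simplices q X adj" "distinct (us @ x # y # ws)" for us ws
  proof -
    have "distinct (us @ y # x # ws)" using that(2) by auto
    then show ?thesis using simplex_class_swap[OF that(1)] that(2)
      by (simp only: simplex_class_def if_True)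
  qed
  let ?A = "\<lambda>zs. frag_of (zs @ x # y # bs) + frag_of (zs @ y # x # bs)"
  let ?B = "\<lambda>zs. frag_of (as @ x # y # zs) + frag_of (as @ y # x # zs)"
  have "simplex_boundary (as @ x # y # bs) + simplex_boundary (as @ y # x # bs)
    = face_sum ?A as + frag_cmul ((-1) ^ length as) (face_sum ?B bs)"
    by (simp add: simplex_boundary_eq face_sum_append face_sum_Cons face_sum_add
        frag_cmul_distrib2[symmetric])
  moreover have "face_sum ?A as \<in> ?R"
  proof (rule orientation.face_sum_mem)
    fix zs assume zs: "Suc (length zs) = length as" "set zs \<subseteq> set as" "distinct as \<Longrightarrow> distinct zs"
    show "?A zs \<in> ?R"
    proof (rule swap)
      show "zs @ x # y # bs \<in> weak_simplices q X adj"
        using weak by (rule weak_simplices_subset) (use zs len in auto)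
      show "distinct (zs @ x # y # bs)" using dist zs by auto
    qed
  qed
  moreover have "face_sum ?B bs \<in> ?R"
  proof (rule orientation.face_sum_mem)
    fix zs assume zs: "Suc (length zs) = length bs" "set zs \<subseteq> set bs" "distinct bs \<Longrightarrow> distinct zs"
    show "?B zs \<in> ?R"
    proof (rule swap)
      show "as @ x # y # zs \<in> weak_simplices q X adj"
        using weak by (rule weak_simplices_subset) (use zs len in auto)
      show "distinct (as @ x # y # zs)" using dist zs by auto
    qed
  qed
  ultimately show "simplex_boundary (as @ x # y # bs) + simplex_boundary (as @ y # x # bs) \<in> ?R"
    by (simp only: orientation.add orientation.cmul)
qed

text \<open>If a point \<open>x\<close> is repeated, the faces that keep both copies vanish. The two
  faces omitting one copy differ by moving \<open>x\<close> across \<open>bs\<close>, and their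
  signs make them cancel modulo the relations.\<close>

lemma face_sum_simplex_class:
  assumes "zs \<in> weak_simplices (Suc q) X adj"
  shows "face_sum simplex_class zs - frag_extend simplex_boundary (simplex_class zs)
    \<in> orientation_relations q X adj"
proof (cases "distinct zs")
  case True
  then have "face_sum simplex_class zs = face_sum frag_of zs"
    by (intro face_sum_cong) (simp add: simplex_class_def)
  then show ?thesis
    using True by (simp add: simplex_class_def simplex_boundary_eq orientation.zero)
next
  case False
  then obtain as x bs cs where zs: "zs = as @ x # bs @ x # cs"
    using not_distinct_decomp by fastforce
  have "face_sum (\<lambda>zs. simplex_class (zs @ x # bs @ x # cs)) as = 0"
    "face_sum (\<lambda>zs. simplex_class (as @ x # zs @ x # cs)) bs = 0"
    "face_sum (\<lambda>zs. simplex_class (as @ x # bs @ x # zs)) cs = 0"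
    by (simp_all add: simplex_class_def face_sum_zero)
  then have "face_sum simplex_class zs = frag_cmul (- ((-1) ^ (length as + length bs)))
      (simplex_class (as @ x # bs @ cs)
        - frag_cmul ((-1) ^ length bs) (simplex_class (as @ bs @ x # cs)))"
    unfolding zs face_sum_append face_sum_Cons
    by (intro poly_mapping_eqI)
      (simp add: lookup_add lookup_minus algebra_simps power_add flip: power_mult_distrib)
  moreover have "as @ x # bs @ cs \<in> weak_simplices q X adj"
    using assms by (rule weak_simplices_subset) (use assms in \<open>auto simp: zs weak_simplices_def\<close>)
  moreover have "simplex_class zs = 0"
    using False by (simp add: simplex_class_def)
  ultimately show ?thesis
    by (simp add: orientation.cmul[OF simplex_class_move] del: minus_frag_cmul)
qed

section \<open>Moving a single vertex\<close>

lemma digitally_continuous_adj_or_eq: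
  assumes "digitally_continuous X adjX Y adjY f" "x \<in> X" "y \<in> X" "adj_or_eq adjX x y"
  shows "adj_or_eq adjY (f x) (f y)"
  using assms unfolding digitally_continuous_def adj_or_eq_def by metis

lemma map_weak_simplices:
  assumes "digitally_continuous X adjX Y adjY f" "xs \<in> weak_simplices q X adjX"
  shows "map f xs \<in> weak_simplices q Y adjY"
proof -
  have "f ` X \<subseteq> Y" using assms(1) by (simp add: digitally_continuous_def)
  moreover have "adj_or_eq adjY (f x) (f y)" if "x \<in> set xs" "y \<in> set xs" for x y
    using assms(2) that
    by (intro digitally_continuous_adj_or_eq[OF assms(1)]) (auto simp: weak_simplices_def)
  moreover have "set xs \<subseteq> X" "length xs = q + 1" using assms(2) by (simp_all add: weak_simplices_def)
  ultimately show ?thesis by (force simp: weak_simplices_def)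
qed

lemma simplex_image_keys:
  assumes "digitally_continuous X adjX Y adjY f" "xs \<in> ordered_simplices q X adjX"
  shows "Poly_Mapping.keys (simplex_image f xs) \<subseteq> ordered_simplices q Y adjY"
  using assms map_weak_simplices[OF assms(1)]
  unfolding simplex_image_eq ordered_simplices_eq[of q X]
  by (intro simplex_class_keys) simp

lemma frag_extend_keys_subset:
  assumes "Poly_Mapping.keys c \<subseteq> T" and "\<And>xs. xs \<in> T \<Longrightarrow> Poly_Mapping.keys (\<phi> xs) \<subseteq> U"
  shows "Poly_Mapping.keys (frag_extend \<phi> c) \<subseteq> U"
  using keys_frag_extend[of \<phi> c] assms by blast

lemma simplex_image_orientation:
  assumes "digitally_continuous X adjX Y adjY f" "c \<in> orientation_relations q X adjX"
  shows "frag_extend (simplex_image f) c \<in> orientation_relations q Y adjY"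
  using frag_subgroup_orientation_relations _ assms(2)
proof (rule alternating_respects_orientation)
  fix as x y bs assume "as @ x # y # bs \<in> ordered_simplices q X adjX"
  then have "map f (as @ x # y # bs) \<in> weak_simplices q Y adjY"
    by (intro map_weak_simplices[OF assms(1)]) (simp only: ordered_simplices_eq mem_Collect_eq)
  then show "simplex_image f (as @ x # y # bs) + simplex_image f (as @ y # x # bs)
      \<in> orientation_relations q Y adjY"
    unfolding simplex_image_eq map_append list.map by (rule simplex_class_swap)
qed

text \<open>The chain homotopy between two maps that differ only at the vertex \<open>v\<close>.\<close>

definition vertex_prism :: "'a \<Rightarrow> ('a \<Rightarrow> 'b) \<Rightarrow> ('a \<Rightarrow> 'b) \<Rightarrow> 'a list \<Rightarrow> 'b list \<Rightarrow>\<^sub>0 int" where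
  "vertex_prism v f g xs =
     (if v \<in> set xs
      then let as = takeWhile (\<lambda>x. x \<noteq> v) xs; bs = tl (dropWhile (\<lambda>x. x \<noteq> v) xs)
        in frag_cmul ((-1) ^ length as) (simplex_class (map f as @ f v # g v # map f bs))
      else 0)"

lemma vertex_prism_notin: "v \<notin> set xs \<Longrightarrow> vertex_prism v f g xs = 0"
  by (simp add: vertex_prism_def)

lemma vertex_prism_split:
  assumes "v \<notin> set as"
  shows "vertex_prism v f g (as @ v # bs)
    = frag_cmul ((-1) ^ length as) (simplex_class (map f as @ f v # g v # map f bs))"
proof -
  have *: "\<forall>x\<in>set as. x \<noteq> v" using assms by auto
  then have "takeWhile (\<lambda>x. x \<noteq> v) (as @ v # bs) = as"
    "dropWhile (\<lambda>x. x \<noteq> v) (as @ v # bs) = v # bs"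
    by (simp_all add: takeWhile_append2 dropWhile_append2)
  then show ?thesis by (simp add: vertex_prism_def)
qed

text \<open>Both orders appear in \<open>move\<close> because weak simplices ask for
  \<open>adj_or_eq\<close> on every ordered pair. The point \<open>v\<close> may lie outside
  \<open>X\<close>; the maps then agree on \<open>X\<close>, a case that occurs when two maps differ
  only off \<open>X\<close>.\<close>

locale vertex_homotopy =
  fixes X :: "'a set" and adjX and Y :: "'b set" and adjY and f g :: "'a \<Rightarrow> 'b" and v :: 'a
  assumes f: "digitally_continuous X adjX Y adjY f"
    and g: "digitally_continuous X adjX Y adjY g"
    and agree: "\<lbrakk>x \<in> X; x \<noteq> v\<rbrakk> \<Longrightarrow> f x = g x"
    and move: "v \<in> X \<Longrightarrow> adj_or_eq adjY (f v) (g v) \<and> adj_or_eq adjY (g v) (f v)"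
begin

text \<open>The new entry \<open>g v\<close> is compatible with \<open>f v\<close> by
  \<open>move\<close>. With any other entry \<open>f x = g x\<close> it is compatible by the
  continuity of \<open>g\<close>.\<close>

lemma prism_weak_simplex:
  assumes "as @ v # bs \<in> weak_simplices q X adjX"
  shows "map f as @ f v # g v # map f bs \<in> weak_simplices (Suc q) Y adjY"
proof -
  let ?V = "set (as @ v # bs)"
  have V: "?V \<subseteq> X" "\<And>x y. x \<in> ?V \<Longrightarrow> y \<in> ?V \<Longrightarrow> adj_or_eq adjX x y" "v \<in> ?V" "v \<in> X"
    using assms by (auto simp: weak_simplices_def)
  have "f ` X \<subseteq> Y" "g ` X \<subseteq> Y"
    using f g by (simp_all add: digitally_continuous_def)
  then have Y: "f ` ?V \<subseteq> Y" "g v \<in> Y" using V by blast+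
  have ff: "adj_or_eq adjY (f x) (f y)" if "x \<in> ?V" "y \<in> ?V" for x y
    using digitally_continuous_adj_or_eq[OF f] V that by blast
  have fg: "adj_or_eq adjY (f x) (g v) \<and> adj_or_eq adjY (g v) (f x)" if "x \<in> ?V" for x
  proof (cases "x = v")
    case True
    then show ?thesis using move V by simp
  next
    case False
    then have "f x = g x" using agree V that by blast
    then show ?thesis using digitally_continuous_adj_or_eq[OF g] V that by (metis subsetD)
  qed
  have set: "set (map f as @ f v # g v # map f bs) = insert (g v) (f ` ?V)" by auto
  have "\<forall>y\<in>insert (g v) (f ` ?V). \<forall>z\<in>insert (g v) (f ` ?V). adj_or_eq adjY y z"
    using ff fg by (force simp: adj_or_eq_def[of _ "g v" "g v"])
  moreover have "length as + length bs = q" using assms by (simp add: weak_simplices_def)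
  ultimately show ?thesis
    unfolding weak_simplices_def mem_Collect_eq set using Y by simp
qed

lemma prism_keys:
  assumes "xs \<in> ordered_simplices q X adjX"
  shows "Poly_Mapping.keys (vertex_prism v f g xs) \<subseteq> ordered_simplices (Suc q) Y adjY"
proof (cases "v \<in> set xs")
  case True
  then obtain as bs where xs: "xs = as @ v # bs" "v \<notin> set as"
    by (meson split_list_first)
  have "xs \<in> weak_simplices q X adjX" using assms by (simp add: ordered_simplices_eq)
  then show ?thesis
    using simplex_class_keys[OF prism_weak_simplex] keys_cmul
    unfolding xs(1) vertex_prism_split[OF xs(2)] by blast
qed (simp add: vertex_prism_notin)

text \<open>Swapping two vertices other than \<open>v\<close> swaps two neighbouring entries of the
  prism and leaves the position of \<open>v\<close> alone. Swapping \<open>v\<close> with a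
  neighbour \<open>y\<close> shifts that position by one, which changes the sign, while
  \<open>f y\<close> passes the two entries \<open>f v\<close> and \<open>g v\<close>, which does
  not.\<close>

lemma prism_orientation:
  assumes "c \<in> orientation_relations q X adjX"
  shows "frag_extend (vertex_prism v f g) c \<in> orientation_relations (Suc q) Y adjY"
  using frag_subgroup_orientation_relations _ assms
proof (rule alternating_respects_orientation)
  let ?R = "orientation_relations (Suc q) Y adjY" and ?D = "vertex_prism v f g"
  have front: "?D (as @ v # y # bs) + ?D (as @ y # v # bs) \<in> ?R"
    if "as @ v # y # bs \<in> ordered_simplices q X adjX" for as y bs
  proof -
    have nv: "v \<notin> set as" "v \<notin> set (as @ [y])"
      using that by (auto simp: ordered_simplices_def)
    have "map f as @ f v # g v # map f (y # bs) \<in> weak_simplices (Suc q) Y adjY"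
      using that by (intro prism_weak_simplex) (simp only: ordered_simplices_eq mem_Collect_eq)
    then have "map f as @ f y # [f v, g v] @ map f bs \<in> weak_simplices (Suc q) Y adjY"
      by (rule iffD1[OF mset_mem_weak_simplices, rotated]) (simp add: add_mset_commute)
    note simplex_class_move[OF this]
    \<comment> \<open>The factor is the prism sign of \<open>as @ y # v # bs\<close>, where
      \<open>v\<close> stands one place further right than in
      \<open>as @ v # y # bs\<close>.\<close>
    then have "frag_cmul (- ((-1) ^ length as))
        (simplex_class (map f as @ f y # [f v, g v] @ map f bs)
         - frag_cmul ((- 1) ^ length [f v, g v]) (simplex_class (map f as @ [f v, g v] @ f y # map f bs)))
      \<in> ?R" by (rule orientation.cmul)
    moreover have "?D ((as @ [y]) @ v # bs)
       = frag_cmul (- ((-1) ^ length as)) (simplex_class (map f as @ f y # [f v, g v] @ map f bs))"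
      using vertex_prism_split[OF nv(2), of f g bs] by simp
    moreover have "?D (as @ v # y # bs)
       = frag_cmul ((-1) ^ length as) (simplex_class (map f as @ [f v, g v] @ f y # map f bs))"
      using vertex_prism_split[OF nv(1), of f g "y # bs"] by simp
    ultimately show ?thesis
      by (simp add: frag_cmul_diff_right algebra_simps flip: minus_frag_cmul)
  qed
  fix as x y bs assume xs: "as @ x # y # bs \<in> ordered_simplices q X adjX"
  then have weak: "as @ x # y # bs \<in> weak_simplices q X adjX"
    by (simp only: ordered_simplices_eq mem_Collect_eq)
  consider "v \<in> set as" | "v = x" | "v = y" | "v \<notin> set (as @ [x, y])" "v \<in> set bs"
    | "v \<notin> set (as @ [x, y] @ bs)" by auto
  then show "?D (as @ x # y # bs) + ?D (as @ y # x # bs) \<in> ?R"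
  proof cases
    case 1
    then obtain as1 as2 where as: "as = as1 @ v # as2" "v \<notin> set as1"
      by (meson split_list_first)
    have "as1 @ v # (as2 @ x # y # bs) \<in> weak_simplices q X adjX"
      using weak as by simp
    from prism_weak_simplex[OF this]
    have "(map f as1 @ f v # g v # map f as2) @ f x # f y # map f bs \<in> weak_simplices (Suc q) Y adjY"
      by simp
    from orientation.cmul[OF simplex_class_swap[OF this], of "(-1) ^ length as1"]
    show ?thesis
      using vertex_prism_split[OF as(2), of f g "as2 @ x # y # bs"]
        vertex_prism_split[OF as(2), of f g "as2 @ y # x # bs"]
      by (simp add: as(1) frag_cmul_distrib2)
  next
    case 2
    then show ?thesis using front xs by simp
  next
    case 3
    have "as @ y # x # bs \<in> ordered_simplices q X adjX"
      using xs by (rule iffD1[OF mset_mem_ordered_simplices, rotated]) (simp add: add_mset_commute)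
    then show ?thesis using front[of as x bs] 3 by (simp add: add.commute)
  next
    case 4
    then obtain bs1 bs2 where bs: "bs = bs1 @ v # bs2" "v \<notin> set bs1"
      by (meson split_list_first)
    have "(as @ x # y # bs1) @ v # bs2 \<in> weak_simplices q X adjX"
      using weak bs by simp
    from prism_weak_simplex[OF this]
    have "map f as @ f x # f y # (map f bs1 @ f v # g v # map f bs2) \<in> weak_simplices (Suc q) Y adjY"
      by simp
    from orientation.cmul[OF simplex_class_swap[OF this], of "(-1) ^ length (as @ x # y # bs1)"]
    have "frag_cmul ((-1) ^ length (as @ x # y # bs1))
        (simplex_class (map f (as @ x # y # bs1) @ f v # g v # map f bs2))
      + frag_cmul ((-1) ^ length (as @ y # x # bs1))
        (simplex_class (map f (as @ y # x # bs1) @ f v # g v # map f bs2)) \<in> ?R"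
      by (simp only: frag_cmul_distrib2 length_append list.size map_append append.simps append_assoc
          list.map)
    moreover have notin: "v \<notin> set (as @ x # y # bs1)" "v \<notin> set (as @ y # x # bs1)"
      using 4 bs by auto
    ultimately have "?D ((as @ x # y # bs1) @ v # bs2) + ?D ((as @ y # x # bs1) @ v # bs2) \<in> ?R"
      by (simp only: notin[THEN vertex_prism_split])
    then show ?thesis by (simp add: bs(1))
  next
    case 5
    then show ?thesis by (simp add: vertex_prism_notin orientation.zero)
  qed
qed

text \<open>The chain homotopy equation, modulo orientation. In the boundary of the prism the faces
  omitting \<open>f v\<close> and \<open>g v\<close> give the two images; the remaining faces
  \<open>A\<close> and \<open>C\<close> cancel against the prism of the boundary, in which the face
  omitting \<open>v\<close> contributes 0.\<close>

lemma prism_identity: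
  assumes xs: "xs \<in> ordered_simplices q X adjX"
  shows "simplex_image g xs - simplex_image f xs
      - frag_extend simplex_boundary (vertex_prism v f g xs)
      - frag_extend (vertex_prism v f g) (simplex_boundary xs) \<in> orientation_relations q Y adjY"
proof (cases "v \<in> set xs")
  case False
  then have "map f xs = map g xs"
    using xs agree by (auto simp: ordered_simplices_def)
  then have "simplex_image g xs = simplex_image f xs"
    by (simp only: simplex_image_eq)
  moreover have "face_sum (vertex_prism v f g) xs = face_sum (\<lambda>zs. 0) xs"
    using False by (intro face_sum_cong vertex_prism_notin) blast
  ultimately show ?thesis
    using False
    by (simp add: vertex_prism_notin frag_extend_simplex_boundary face_sum_zero
        orientation.zero)
next
  case True
  then obtain as bs where split: "xs = as @ v # bs" "v \<notin> set as"
    by (meson split_list_first)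
  have vbs: "v \<notin> set bs" using xs by (simp add: split ordered_simplices_def)
  define s :: int where "s = (-1) ^ length as"
  have ss: "s * s = 1" by (simp add: s_def flip: power_mult_distrib)
  let ?D = "vertex_prism v f g"
  let ?W = "map f as @ f v # g v # map f bs"
  define A where "A = face_sum (\<lambda>zs. simplex_class (map f zs @ f v # g v # map f bs)) as"
  define C where "C = face_sum (\<lambda>zs. simplex_class (map f as @ f v # g v # map f zs)) bs"
  \<comment> \<open>As \<open>v\<close> occurs only once in \<open>xs\<close>, the maps agree on all
    its other vertices. So deleting \<open>f v\<close> or \<open>g v\<close> from \<open>?W\<close>
    leaves the image of \<open>xs\<close> under \<open>g\<close> or \<open>f\<close>.\<close>
  have "map f as = map g as" "map f bs = map g bs"
    using xs agree split vbs by (auto simp: ordered_simplices_def)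
  then have images: "simplex_class (map f as @ g v # map f bs) = simplex_image g xs"
    "simplex_class (map f as @ f v # map f bs) = simplex_image f xs"
    by (simp_all only: simplex_image_eq split map_append list.map)
  have W: "face_sum simplex_class ?W
      = A + frag_cmul s (simplex_image g xs - (simplex_image f xs - C))"
    by (simp add: face_sum_append face_sum_Cons face_sum_map images A_def C_def s_def)
  \<comment> \<open>Omitting a vertex in front of \<open>v\<close> moves \<open>v\<close> one place
    to the left, which turns the prism sign \<open>s\<close> into \<open>- s\<close>.\<close>
  have "face_sum (\<lambda>zs. ?D (zs @ v # bs)) as
      = face_sum (\<lambda>zs. frag_cmul (- s) (simplex_class (map f zs @ f v # g v # map f bs))) as"
  proof (rule face_sum_cong)
    fix zs assume zs: "Suc (length zs) = length as" "set zs \<subseteq> set as"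
    then have "v \<notin> set zs" using split by auto
    then show "?D (zs @ v # bs) = frag_cmul (- s) (simplex_class (map f zs @ f v # g v # map f bs))"
      by (simp add: vertex_prism_split s_def flip: zs(1))
  qed
  then have "face_sum ?D xs = frag_cmul (- s) A - frag_cmul s (frag_cmul s C)"
    using split vbs
    by (simp add: face_sum_append face_sum_Cons face_sum_cmul vertex_prism_split
        vertex_prism_notin A_def C_def s_def)
  then have D: "face_sum ?D xs = - frag_cmul s A - C" using ss by simp
  have "?W \<in> weak_simplices (Suc q) Y adjY"
    using xs by (intro prism_weak_simplex) (simp add: ordered_simplices_eq split)
  \<comment> \<open>The list \<open>?W\<close> may have repetitions, for instance if
    \<open>f v = g v\<close>, so its face sum is the boundary of its class only modulo the
    relations.\<close>
  note orientation.cmul[OF face_sum_simplex_class[OF this], of s]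
  moreover have "frag_cmul s (face_sum simplex_class ?W
        - frag_extend simplex_boundary (simplex_class ?W))
      = simplex_image g xs - simplex_image f xs
      - frag_extend simplex_boundary (?D xs) - face_sum ?D xs"
    unfolding D W unfolding split(1) vertex_prism_split[OF split(2)] frag_extend_cmul s_def[symmetric]
    by (intro poly_mapping_eqI)
      (simp add: lookup_add lookup_minus algebra_simps ss mult.assoc[symmetric])
  ultimately show ?thesis by (simp add: frag_extend_simplex_boundary)
qed

lemma prism_identity_extend:
  assumes "Poly_Mapping.keys c \<subseteq> ordered_simplices q X adjX"
  shows "frag_extend (simplex_image g) c - frag_extend (simplex_image f) c
      - frag_extend simplex_boundary (frag_extend (vertex_prism v f g) c)
      - frag_extend (vertex_prism v f g) (frag_extend simplex_boundary c)
    \<in> orientation_relations q Y adjY"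
  using assms
proof (induction c rule: frag_induction)
  case zero
  then show ?case by (simp add: orientation.zero)
next
  case (one xs)
  then show ?case using prism_identity by simp
next
  case (diff a b)
  from orientation.diff[OF diff] show ?case
    by (simp add: frag_extend_diff algebra_simps)
qed

end

section \<open>Passage to homology\<close>

lemma simplex_boundary_keys:
  assumes "xs \<in> ordered_simplices (Suc q) X adj"
  shows "Poly_Mapping.keys (simplex_boundary xs) \<subseteq> ordered_simplices q X adj"
proof -
  interpret keys: frag_subgroup "{c. Poly_Mapping.keys c \<subseteq> ordered_simplices q X adj}"
    using keys_diff by unfold_locales fastforce+
  have "face_sum frag_of xs \<in> {c. Poly_Mapping.keys c \<subseteq> ordered_simplices q X adj}"
  proof (rule keys.face_sum_mem)
    fix zs assume zs: "Suc (length zs) = length xs" "set zs \<subseteq> set xs" "distinct xs \<Longrightarrow> distinct zs"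
    have "zs \<in> weak_simplices q X adj"
    proof (rule weak_simplices_subset)
      show "xs \<in> weak_simplices (Suc q) X adj" using assms by (simp add: ordered_simplices_eq)
      show "length zs = q + 1" using assms zs(1) by (simp add: ordered_simplices_def)
    qed (rule zs(2))
    then show "frag_of zs \<in> {c. Poly_Mapping.keys c \<subseteq> ordered_simplices q X adj}"
      using assms zs(3) by (simp add: ordered_simplices_eq)
  qed
  then show ?thesis by (simp add: simplex_boundary_eq)
qed

text \<open>The square vanishes already for formal sums of lists. Omitting \<open>x\<close> first
  and omitting it second give \<open>face_sum \<phi> xs\<close> with opposite signs; the faces that
  keep \<open>x\<close> vanish by induction, applied to
  \<open>\<lambda>ws. \<phi> (x # ws)\<close>.\<close>

lemma face_sum_face_sum: "face_sum (face_sum \<phi>) xs = 0"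
proof (induction xs arbitrary: \<phi>)
  case (Cons x xs)
  have "face_sum (\<lambda>zs. face_sum \<phi> (x # zs)) xs
      = face_sum (\<lambda>zs. \<phi> zs + frag_cmul (-1) (face_sum (\<lambda>ws. \<phi> (x # ws)) zs)) xs"
    by (simp add: face_sum_Cons)
  also have "\<dots> = face_sum \<phi> xs + frag_cmul (-1) (face_sum (face_sum (\<lambda>ws. \<phi> (x # ws))) xs)"
    by (simp only: face_sum_add face_sum_cmul)
  finally show ?case using Cons.IH by (simp add: face_sum_Cons)
qed (simp add: face_sum_Nil)

lemma simplex_boundary_boundary:
  "frag_extend simplex_boundary (frag_extend simplex_boundary c) = 0"
proof (induction c rule: frag_induction[OF subset_UNIV])
  case (2 xs)
  then show ?case
    by (simp add: frag_extend_simplex_boundary) (simp add: simplex_boundary_eq face_sum_face_sum)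
qed (simp_all add: frag_extend_diff)

section \<open>Chains as classes of formal sums, and maps computed on representatives\<close>

definition simplicial_chain ::
    "nat \<Rightarrow> 'a set \<Rightarrow> ('a \<Rightarrow> 'a \<Rightarrow> bool) \<Rightarrow> ('a list \<Rightarrow>\<^sub>0 int) \<Rightarrow> ('a list \<Rightarrow>\<^sub>0 int) set" where
  "simplicial_chain q X adj z = orientation_relations q X adj #>\<^bsub>free_chain_group q X adj\<^esub> z"

lemma mem_simplicial_chain:
  "w \<in> simplicial_chain q X adj z \<longleftrightarrow> w - z \<in> orientation_relations q X adj"
proof
  assume "w - z \<in> orientation_relations q X adj"
  then show "w \<in> simplicial_chain q X adj z"
    unfolding simplicial_chain_def r_coset_def by (auto intro!: bexI[of _ "w - z"])
qed (auto simp: simplicial_chain_def r_coset_def)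

lemma simplicial_chain_eq_iff:
  "simplicial_chain q X adj z = simplicial_chain q X adj w
    \<longleftrightarrow> z - w \<in> orientation_relations q X adj"
proof
  show "z - w \<in> orientation_relations q X adj"
    if "simplicial_chain q X adj z = simplicial_chain q X adj w"
    using that mem_simplicial_chain[of z q X adj z] mem_simplicial_chain[of z q X adj w]
    by (simp add: orientation.zero)
  assume *: "z - w \<in> orientation_relations q X adj"
  have "u - z \<in> orientation_relations q X adj \<longleftrightarrow> u - w \<in> orientation_relations q X adj" for u
    using orientation.add[OF _ *, of "u - z"] orientation.diff[OF _ *, of "u - w"] by auto
  then show "simplicial_chain q X adj z = simplicial_chain q X adj w"
    by (auto simp: mem_simplicial_chain)
qed

lemma carrier_simplicial_chain_group:
  "carrier (simplicial_chain_group q X adj)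
    = simplicial_chain q X adj ` {z. Poly_Mapping.keys z \<subseteq> ordered_simplices q X adj}"
  unfolding simplicial_chain_group_def carrier_FactGroup simplicial_chain_def
  by (simp add: free_Abelian_group_def)

lemma one_simplicial_chain_group:
  "\<one>\<^bsub>simplicial_chain_group q X adj\<^esub> = simplicial_chain q X adj 0"
  by (auto simp: simplicial_chain_group_def mem_simplicial_chain)

lemma normal_orientation_relations:
  "orientation_relations q X adj \<lhd> free_chain_group q X adj"
  using abelian_free_Abelian_group subgroup_orientation_relations
  by (rule comm_group.subgroup_imp_normal)

lemma group_simplicial_chain_group: "group (simplicial_chain_group q X adj)"
  unfolding simplicial_chain_group_def
  using normal_orientation_relations by (rule normal.factorgroup_is_group)

lemma mult_simplicial_chain_group:
  assumes "Poly_Mapping.keys z \<subseteq> ordered_simplices q X adj"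
    "Poly_Mapping.keys w \<subseteq> ordered_simplices q X adj"
  shows "simplicial_chain q X adj z \<otimes>\<^bsub>simplicial_chain_group q X adj\<^esub> simplicial_chain q X adj w
    = simplicial_chain q X adj (z + w)"
  using normal.rcos_sum[OF normal_orientation_relations, of z q X adj w] assms
  by (simp add: simplicial_chain_group_def simplicial_chain_def)

text \<open>The class contains \<open>z\<close>, and by assumption all its members have images in
  the same coset. Hence \<open>the_elem\<close> is applied to a singleton.\<close>

lemma quotient_map_of_simplicial_chain:
  assumes "\<And>c. c \<in> orientation_relations q X adjX \<Longrightarrow>
    frag_extend \<phi> c \<in> orientation_relations p Y adjY"
  shows "quotient_map_of (free_chain_group p Y adjY) (orientation_relations p Y adjY)
      (frag_extend \<phi>) (simplicial_chain q X adjX z)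
    = simplicial_chain p Y adjY (frag_extend \<phi> z)"
proof -
  have "(\<lambda>a. simplicial_chain p Y adjY (frag_extend \<phi> a)) ` simplicial_chain q X adjX z
      = {simplicial_chain p Y adjY (frag_extend \<phi> z)}"
  proof (intro equalityI subsetI)
    fix C assume "C \<in> {simplicial_chain p Y adjY (frag_extend \<phi> z)}"
    moreover have "z \<in> simplicial_chain q X adjX z"
      by (simp add: mem_simplicial_chain orientation.zero)
    ultimately show "C \<in> (\<lambda>a. simplicial_chain p Y adjY (frag_extend \<phi> a)) ` simplicial_chain q X adjX z"
      by blast
  next
    fix C assume "C \<in> (\<lambda>a. simplicial_chain p Y adjY (frag_extend \<phi> a)) ` simplicial_chain q X adjX z"
    then obtain a where "a - z \<in> orientation_relations q X adjX"
      "C = simplicial_chain p Y adjY (frag_extend \<phi> a)"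
      by (auto simp: mem_simplicial_chain)
    then show "C \<in> {simplicial_chain p Y adjY (frag_extend \<phi> z)}"
      using assms[of "a - z"] by (simp add: simplicial_chain_eq_iff frag_extend_diff)
  qed
  then show ?thesis
    unfolding quotient_map_of_def simplicial_chain_def[symmetric] by simp
qed

lemma boundary_simplicial_chain:
  "boundary (Suc q) X adj (simplicial_chain (Suc q) X adj z)
    = simplicial_chain q X adj (frag_extend simplex_boundary z)"
  by (simp add: boundary_def quotient_map_of_simplicial_chain simplex_boundary_orientation)

lemma induced_chain_map_simplicial_chain:
  assumes "digitally_continuous X adjX Y adjY f"
  shows "induced_chain_map q Y adjY f (simplicial_chain q X adjX z)
    = simplicial_chain q Y adjY (frag_extend (simplex_image f) z)"
  using assms
  by (simp add: induced_chain_map_def quotient_map_of_simplicial_chain simplex_image_orientation)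

section \<open>The subgroups of cycles and boundaries\<close>

lemma boundary_hom:
  "boundary q X adj \<in> hom (simplicial_chain_group q X adj) (simplicial_chain_group (q - 1) X adj)"
proof (cases q)
  case 0
  interpret group "simplicial_chain_group 0 X adj"
    by (rule group_simplicial_chain_group)
  show ?thesis unfolding 0 boundary_def by (auto simp: hom_def)
next
  case (Suc p)
  show ?thesis
  proof (rule homI)
    fix C D assume CD: "C \<in> carrier (simplicial_chain_group q X adj)"
      "D \<in> carrier (simplicial_chain_group q X adj)"
    then obtain z w where C: "C = simplicial_chain (Suc p) X adj z"
      and D: "D = simplicial_chain (Suc p) X adj w"
      and keys: "Poly_Mapping.keys z \<subseteq> ordered_simplices (Suc p) X adj"
        "Poly_Mapping.keys w \<subseteq> ordered_simplices (Suc p) X adj"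
      unfolding carrier_simplicial_chain_group Suc by blast
    have bkeys: "Poly_Mapping.keys (frag_extend simplex_boundary z) \<subseteq> ordered_simplices p X adj"
      "Poly_Mapping.keys (frag_extend simplex_boundary w) \<subseteq> ordered_simplices p X adj"
      using keys by (auto intro: frag_extend_keys_subset simplex_boundary_keys del: subsetI)
    show "boundary q X adj C \<in> carrier (simplicial_chain_group (q - 1) X adj)"
      using bkeys by (auto simp: carrier_simplicial_chain_group C Suc boundary_simplicial_chain)
    show "boundary q X adj (C \<otimes>\<^bsub>simplicial_chain_group q X adj\<^esub> D)
      = boundary q X adj C \<otimes>\<^bsub>simplicial_chain_group (q - 1) X adj\<^esub> boundary q X adj D"
      by (simp add: C D Suc boundary_simplicial_chain mult_simplicial_chain_group keys bkeys
          frag_extend_add)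
  qed
qed

lemma boundary_group_hom:
  "group_hom (simplicial_chain_group q X adj) (simplicial_chain_group (q - 1) X adj) (boundary q X adj)"
  using group_simplicial_chain_group boundary_hom by (intro group_hom.intro group_hom_axioms.intro)

lemma subgroup_simplicial_cycles:
  "subgroup (simplicial_cycles q X adj) (simplicial_chain_group q X adj)"
  unfolding simplicial_cycles_def using boundary_group_hom by (rule group_hom.subgroup_kernel)

lemma subgroup_simplicial_boundaries:
  "subgroup (simplicial_boundaries q X adj) (simplicial_chain_group q X adj)"
  unfolding simplicial_boundaries_def
  using group_hom.img_is_subgroup[OF boundary_group_hom[of "q + 1" X adj]] by simp

lemma simplicial_boundaries_subset_cycles:
  "simplicial_boundaries q X adj \<subseteq> simplicial_cycles q X adj"
proof
  fix B assume B: "B \<in> simplicial_boundaries q X adj"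
  then have carr: "B \<in> carrier (simplicial_chain_group q X adj)"
    using subgroup_simplicial_boundaries by (meson subgroup.mem_carrier)
  obtain z where z: "B = simplicial_chain q X adj (frag_extend simplex_boundary z)"
    using B by (auto simp: simplicial_boundaries_def carrier_simplicial_chain_group
        boundary_simplicial_chain)
  have "boundary q X adj B = \<one>\<^bsub>simplicial_chain_group (q - 1) X adj\<^esub>"
  proof (cases q)
    case 0
    then show ?thesis by (simp add: boundary_def)
  next
    case (Suc p)
    then show ?thesis
      by (simp add: z boundary_simplicial_chain simplex_boundary_boundary one_simplicial_chain_group)
  qed
  then show "B \<in> simplicial_cycles q X adj"
    using carr by (simp add: simplicial_cycles_def kernel_def)
qed

lemma carrier_cycle_group: "carrier (cycle_group q X adj) = simplicial_cycles q X adj"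
  using subgroup_simplicial_cycles by (rule subgroup.carrier_subgroup_generated_subgroup)

text \<open>\<open>quotient_map_of\<close> evaluates a map at every member of \<open>A\<close>, so
  all of them have to be known to be cycles. Each is the sum of a cycle and a boundary, and
  boundaries are cycles.\<close>

lemma mem_homology_class:
  assumes "A \<in> carrier (simplicial_homology_group q X adj)" and "C \<in> A"
  shows "C \<in> simplicial_cycles q X adj"
proof -
  obtain D where D: "D \<in> simplicial_cycles q X adj"
    and A: "A = simplicial_boundaries q X adj #>\<^bsub>simplicial_chain_group q X adj\<^esub> D"
    using assms(1)
    by (auto simp: simplicial_homology_group_def carrier_FactGroup carrier_cycle_group r_coset_def)
  obtain B where "B \<in> simplicial_boundaries q X adj"
    and C: "C = B \<otimes>\<^bsub>simplicial_chain_group q X adj\<^esub> D"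
    using assms(2) unfolding A r_coset_def by blast
  then have "B \<in> simplicial_cycles q X adj"
    using simplicial_boundaries_subset_cycles by blast
  then show ?thesis
    unfolding C using D by (rule subgroup.m_closed[OF subgroup_simplicial_cycles])
qed

text \<open>A transitive form of equality on homology, evaluated at single cycles, which allows a
  homotopy to be treated step by step. Cosets are taken in the whole chain group; they equal those
  in \<open>cycle_group\<close>, which has the same multiplication.\<close>

definition homologous_maps ::
    "'a set \<Rightarrow> ('a \<Rightarrow> 'a \<Rightarrow> bool) \<Rightarrow> 'b set \<Rightarrow> ('b \<Rightarrow> 'b \<Rightarrow> bool) \<Rightarrow> ('a \<Rightarrow> 'b) \<Rightarrow> ('a \<Rightarrow> 'b) \<Rightarrow> bool" where
  "homologous_maps X adjX Y adjY f g \<longleftrightarrow> (\<forall>q. \<forall>C\<in>simplicial_cycles q X adjX.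
     simplicial_boundaries q Y adjY #>\<^bsub>simplicial_chain_group q Y adjY\<^esub> induced_chain_map q Y adjY f C
     = simplicial_boundaries q Y adjY #>\<^bsub>simplicial_chain_group q Y adjY\<^esub> induced_chain_map q Y adjY g C)"

lemma homologous_maps_refl: "homologous_maps X adjX Y adjY f f"
  by (simp add: homologous_maps_def)

lemma homologous_maps_trans:
  "\<lbrakk>homologous_maps X adjX Y adjY f g; homologous_maps X adjX Y adjY g h\<rbrakk>
    \<Longrightarrow> homologous_maps X adjX Y adjY f h"
  by (simp add: homologous_maps_def)

lemma homologous_maps_induced_homology_map:
  assumes "homologous_maps X adjX Y adjY f g"
    and "A \<in> carrier (simplicial_homology_group q X adjX)"
  shows "induced_homology_map q Y adjY f A = induced_homology_map q Y adjY g A"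
proof -
  have "simplicial_boundaries q Y adjY #>\<^bsub>cycle_group q Y adjY\<^esub> induced_chain_map q Y adjY f C
      = simplicial_boundaries q Y adjY #>\<^bsub>cycle_group q Y adjY\<^esub> induced_chain_map q Y adjY g C"
    if "C \<in> A" for C
    using assms mem_homology_class[OF assms(2) that]
    by (simp add: homologous_maps_def r_coset_def)
  then show ?thesis
    unfolding induced_homology_map_def quotient_map_of_def by (simp cong: image_cong)
qed

context vertex_homotopy
begin

text \<open>Removes the second prism term of the homotopy equation on cycles: the boundary of a
  representative is then an orientation relation, and the prism preserves these.\<close>

lemma prism_boundary_orientation:
  assumes "simplicial_chain q X adjX z \<in> simplicial_cycles q X adjX"
    and keys: "Poly_Mapping.keys z \<subseteq> ordered_simplices q X adjX"
  shows "frag_extend (vertex_prism v f g) (frag_extend simplex_boundary z)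
    \<in> orientation_relations q Y adjY"
proof (cases q)
  case 0
  \<comment> \<open>In degree 0 \<open>boundary\<close> is zero by definition, whereas
    \<open>simplex_boundary [x]\<close> is \<open>frag_of []\<close>. The prism vanishes on the
    empty list.\<close>
  have "frag_extend (vertex_prism v f g) (frag_extend simplex_boundary z) = 0"
    using keys
  proof (induction z rule: frag_induction)
    case (one xs)
    then obtain x where "xs = [x]"
      by (auto simp: 0 ordered_simplices_def length_Suc_conv)
    then show ?case
      by (simp add: frag_extend_simplex_boundary face_sum_Cons face_sum_Nil vertex_prism_notin)
  qed (simp_all add: frag_extend_diff)
  then show ?thesis by (simp add: orientation.zero)
next
  case (Suc p)
  have "simplicial_chain p X adjX (frag_extend simplex_boundary z) = simplicial_chain p X adjX 0"
    using assms(1)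
    by (simp add: simplicial_cycles_def kernel_def Suc boundary_simplicial_chain
        one_simplicial_chain_group)
  then show ?thesis
    using prism_orientation Suc by (simp add: simplicial_chain_eq_iff)
qed

text \<open>On a cycle represented by \<open>z\<close>, the homotopy equation says that the image
  under \<open>g\<close> is the image under \<open>f\<close> plus the boundary of the prism
  \<open>?w\<close>. The coset of boundaries absorbs that boundary.\<close>

lemma homologous_maps_vertex: "homologous_maps X adjX Y adjY f g"
  unfolding homologous_maps_def
proof (intro allI ballI)
  fix q C assume C: "C \<in> simplicial_cycles q X adjX"
  then have "C \<in> carrier (simplicial_chain_group q X adjX)"
    by (simp add: simplicial_cycles_def kernel_def)
  then obtain z where z: "C = simplicial_chain q X adjX z"
    and keys: "Poly_Mapping.keys z \<subseteq> ordered_simplices q X adjX"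
    by (auto simp: carrier_simplicial_chain_group)
  interpret G: group "simplicial_chain_group q Y adjY"
    by (rule group_simplicial_chain_group)
  interpret B: subgroup "simplicial_boundaries q Y adjY" "simplicial_chain_group q Y adjY"
    by (rule subgroup_simplicial_boundaries)
  let ?f = "frag_extend (simplex_image f) z" and ?g = "frag_extend (simplex_image g) z"
  let ?w = "frag_extend (vertex_prism v f g) z"
  let ?b = "frag_extend simplex_boundary ?w"
  have keysf: "Poly_Mapping.keys ?f \<subseteq> ordered_simplices q Y adjY"
    using keys simplex_image_keys[OF f] by (rule frag_extend_keys_subset)
  have keysw: "Poly_Mapping.keys ?w \<subseteq> ordered_simplices (Suc q) Y adjY"
    using keys prism_keys by (rule frag_extend_keys_subset)
  then have keysb: "Poly_Mapping.keys ?b \<subseteq> ordered_simplices q Y adjY"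
    using simplex_boundary_keys by (rule frag_extend_keys_subset)
  have b: "simplicial_chain q Y adjY ?b \<in> simplicial_boundaries q Y adjY"
    unfolding simplicial_boundaries_def carrier_simplicial_chain_group
    using keysw by (auto simp: boundary_simplicial_chain intro!: image_eqI[of _ _ "simplicial_chain (Suc q) Y adjY ?w"])
  have "?g - (?b + ?f) \<in> orientation_relations q Y adjY"
    using orientation.add[OF prism_identity_extend[OF keys] prism_boundary_orientation[OF C[unfolded z] keys]]
    by (simp add: algebra_simps)
  then have "induced_chain_map q Y adjY g C = simplicial_chain q Y adjY (?b + ?f)"
    by (simp add: z induced_chain_map_simplicial_chain[OF g] simplicial_chain_eq_iff)
  also have "\<dots> = simplicial_chain q Y adjY ?b \<otimes>\<^bsub>simplicial_chain_group q Y adjY\<^esub>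
      induced_chain_map q Y adjY f C"
    by (simp add: z induced_chain_map_simplicial_chain[OF f] mult_simplicial_chain_group keysb keysf)
  finally have g_eq: "induced_chain_map q Y adjY g C = \<dots>" .
  have carr: "induced_chain_map q Y adjY f C \<in> carrier (simplicial_chain_group q Y adjY)"
    using keysf by (simp add: z induced_chain_map_simplicial_chain[OF f] carrier_simplicial_chain_group)
  have "simplicial_boundaries q Y adjY #>\<^bsub>simplicial_chain_group q Y adjY\<^esub> simplicial_chain q Y adjY ?b
      = simplicial_boundaries q Y adjY"
    using b B.mem_carrier B.subgroup_axioms by (intro G.coset_join2)
  then show "simplicial_boundaries q Y adjY #>\<^bsub>simplicial_chain_group q Y adjY\<^esub> induced_chain_map q Y adjY f C
      = simplicial_boundaries q Y adjY #>\<^bsub>simplicial_chain_group q Y adjY\<^esub> induced_chain_map q Y adjY g C"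
    unfolding g_eq
    using G.coset_mult_assoc[OF B.subset B.mem_carrier[OF b] carr] by simp
qed

end

text \<open>By \<open>close\<close>, every map choosing \<open>f x\<close> or \<open>g x\<close> at
  each point of \<open>X\<close> is continuous, so all maps between \<open>f\<close> and
  \<open>g\<close> are admissible. The case \<open>x = x'\<close> provides the condition
  \<open>move\<close> for a single vertex.\<close>

lemma homologous_maps_close:
  assumes "finite X"
    and Y: "\<And>x. x \<in> X \<Longrightarrow> f x \<in> Y \<and> g x \<in> Y"
    and close: "\<And>x x' y y'. \<lbrakk>x \<in> X; x' \<in> X; adj_or_eq adjX x x'; y \<in> {f x, g x}; y' \<in> {f x', g x'}\<rbrakk>
      \<Longrightarrow> adj_or_eq adjY y y'"
  shows "homologous_maps X adjX Y adjY f g"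
proof -
  have cont: "digitally_continuous X adjX Y adjY h"
    if h: "\<And>x. x \<in> X \<Longrightarrow> h x \<in> {f x, g x}" for h
    unfolding digitally_continuous_def
  proof (intro conjI ballI impI image_subsetI)
    show "h x \<in> Y" if "x \<in> X" for x using h[OF that] Y[OF that] by auto
    fix x x' assume x: "x \<in> X" "x' \<in> X" and "adjX x x'"
    then show "adj_or_eq adjY (h x) (h x')"
      by (intro close[OF x _ h[OF x(1)] h[OF x(2)]]) (simp add: adj_or_eq_def)
  qed
  have step: "homologous_maps X adjX Y adjY h k"
    if h: "\<And>x. x \<in> X \<Longrightarrow> h x \<in> {f x, g x}" and k: "\<And>x. x \<in> X \<Longrightarrow> k x \<in> {f x, g x}"
      and agree: "\<And>x. \<lbrakk>x \<in> X; x \<noteq> v\<rbrakk> \<Longrightarrow> h x = k x" for h k v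
  proof (rule vertex_homotopy.homologous_maps_vertex)
    show "vertex_homotopy X adjX Y adjY h k v"
    proof
      show "digitally_continuous X adjX Y adjY h" "digitally_continuous X adjX Y adjY k"
        by (rule cont, erule h) (rule cont, erule k)
      show "h x = k x" if "x \<in> X" "x \<noteq> v" for x
        using that by (rule agree)
      assume v: "v \<in> X"
      have "adj_or_eq adjX v v" by (simp add: adj_or_eq_def)
      then show "adj_or_eq adjY (h v) (k v) \<and> adj_or_eq adjY (k v) (h v)"
        using close[OF v v _ h[OF v] k[OF v]] close[OF v v _ k[OF v] h[OF v]] by blast
    qed
  qed
  \<comment> \<open>The intermediate maps are already \<open>g\<close> on \<open>T\<close> and still
    \<open>f\<close> elsewhere; inserting \<open>v\<close> into \<open>T\<close> changes at most the
    value at \<open>v\<close>.\<close>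
  have "homologous_maps X adjX Y adjY f (\<lambda>x. if x \<in> T then g x else f x)" if "finite T" for T
    using that
  proof (induction T rule: finite_induct)
    case empty
    then show ?case by (simp add: homologous_maps_refl)
  next
    case (insert v T)
    have "homologous_maps X adjX Y adjY (\<lambda>x. if x \<in> T then g x else f x)
        (\<lambda>x. if x \<in> insert v T then g x else f x)"
      by (rule step[where v = v]) auto
    with insert.IH show ?case by (rule homologous_maps_trans)
  qed
  from this[OF \<open>finite X\<close>] have "homologous_maps X adjX Y adjY f (\<lambda>x. if x \<in> X then g x else f x)" .
  also have "homologous_maps X adjX Y adjY (\<lambda>x. if x \<in> X then g x else f x) g"
    \<comment> \<open>the maps may differ outside \<open>X\<close>, but agree on \<open>X\<close>, so the vertex is irrelevant\<close>
    by (rule step[where v = undefined]) auto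
  finally (homologous_maps_trans) show ?thesis .
qed

theorem theorem40:
  fixes X :: "'a set" and adjX :: "'a \<Rightarrow> 'a \<Rightarrow> bool"
    and Y :: "'b set" and adjY :: "'b \<Rightarrow> 'b \<Rightarrow> bool"
    and f g :: "'a \<Rightarrow> 'b"
  assumes "digital_image X adjX" and "finite X"
    and "digital_image Y adjY"
    and "digitally_continuous X adjX Y adjY f"
    and "digitally_continuous X adjX Y adjY g"
    and "strongly_homotopic X adjX Y adjY f g"
  shows "\<forall>q::nat. \<forall>A \<in> carrier (simplicial_homology_group q X adjX).
           induced_homology_map q Y adjY f A = induced_homology_map q Y adjY g A"
proof -
  obtain k :: int and H where "k > 0"
    and H: "digitally_continuous (X \<times> {0..k}) (NP2 adjX int_adj) Y adjY H"
    and ends: "\<And>x. x \<in> X \<Longrightarrow> H (x, 0) = f x \<and> H (x, k) = g x"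
    using assms(6) unfolding strongly_homotopic_def by blast
  have HY: "H (x, t) \<in> Y" if "x \<in> X" "t \<in> {0..k}" for x t
    using H that by (auto simp: digitally_continuous_def)
  \<comment> \<open>Equal times are included, since \<open>close\<close> compares points within one
    level of the homotopy as well as across two consecutive levels.\<close>
  have H_adj: "adj_or_eq adjY (H (x, t)) (H (x', t'))"
    if "x \<in> X" "x' \<in> X" "adj_or_eq adjX x x'" "t \<in> {0..k}" "t' \<in> {0..k}" "\<bar>t - t'\<bar> \<le> 1"
    for x x' t t'
  proof (rule digitally_continuous_adj_or_eq[OF H])
    show "adj_or_eq (NP2 adjX int_adj) (x, t) (x', t')"
      using that by (auto simp: adj_or_eq_def NP2_def int_adj_def)
  qed (use that in auto)
  have "homologous_maps X adjX Y adjY f (\<lambda>x. H (x, int n))" if "int n \<le> k" for n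
    using that
  proof (induction n)
    case 0
    \<comment> \<open>\<open>H\<close> starts with \<open>f\<close> only on \<open>X\<close>, so the
      two functions still have to be compared as close maps.\<close>
    show ?case
      using H_adj[of _ _ 0 0] HY[of _ 0] \<open>k > 0\<close> ends
      by (intro homologous_maps_close[OF \<open>finite X\<close>]) auto
  next
    case (Suc n)
    have "homologous_maps X adjX Y adjY (\<lambda>x. H (x, int n)) (\<lambda>x. H (x, int (Suc n)))"
      using Suc.prems HY
      by (intro homologous_maps_close[OF \<open>finite X\<close>]) (auto intro!: H_adj)
    then show ?case
      using Suc homologous_maps_trans by fastforce
  qed
  from this[of "nat k"] have "homologous_maps X adjX Y adjY f (\<lambda>x. H (x, k))"
    using \<open>k > 0\<close> by simp
  \<comment> \<open>At the last level too, the agreement with \<open>g\<close> is known only on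
    \<open>X\<close>.\<close>
  also have "homologous_maps X adjX Y adjY (\<lambda>x. H (x, k)) g"
    using H_adj[of _ _ k k] HY[of _ k] \<open>k > 0\<close> ends
    by (intro homologous_maps_close[OF \<open>finite X\<close>]) auto
  finally (homologous_maps_trans) have "homologous_maps X adjX Y adjY f g" .
  then show ?thesis using homologous_maps_induced_homology_map by blast
qed

end
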